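(* Let $f(x)=\arctan x-\dfrac{3x}{1+2\sqrt{1+x^2}}$. Define $C(0)=C(1)=0$ and, for every integer $m\ge 2$, $$C(m)=\frac{1}{2m+1}-\frac{4^{m-1}}{3^m}\left(1-8\sum_{i=2}^{m}\frac{(2i-2)!}{(i-1)!\,i!\,2^{2i-1}}\left(\frac34\right)^{i}\right).$$ Then for every positive integer $k$ and every real $x\in\left(0,\frac{\sqrt3}{2}\right]$, $$\sum_{m=0}^{2k+1}(-1)^m C(m)\,x^{2m+1}<f(x)<\sum_{m=0}^{2k}(-1)^m C(m)\,x^{2m+1}.$$ *)

theory Defs
  imports Complex_Main
begin

definition f :: "real \<Rightarrow> real" where
  "f x = arctan x - 3 * x / (1 + 2 * sqrt (1 + x\<^sup>2))"

text \<open>For \<open>m \<ge> 2\<close> and \<open>2 \<le> i \<le> m\<close> none of the natural-number subtractions below truncates.\<close>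

definition C :: "nat \<Rightarrow> real" where
  "C m = (if m < 2 then 0 else
     1 / (2 * real m + 1)
     - 4 ^ (m - 1) / 3 ^ m *
       (1 - 8 * (\<Sum>i = 2..m. fact (2 * i - 2) / (fact (i - 1) * fact i * 2 ^ (2 * i - 1)) * (3 / 4) ^ i)))"

end

theory Submission
  imports Defs "HOL-Analysis.Generalised_Binomial_Theorem"
begin

text \<open>
  Rationalising the denominator, \<open>3 x / (1 + 2 s) = x (2 s - 1) / (1 + 4 x\<^sup>2 / 3)\<close> with
  \<open>s = sqrt (1 + x\<^sup>2)\<close>. Dividing the binomial series of \<open>2 s - 1\<close> by \<open>1 + 4 x\<^sup>2 / 3\<close> and
  subtracting from the arctangent series shows that \<open>f\<close> is the sum of the alternating series
  with coefficients \<open>C m\<close>. Its terms decrease only from \<open>m = 3\<close> on, which is why \<open>k \<ge> 1\<close>;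
  at the extreme point \<open>x\<^sup>2 = 3/4\<close> the decrease reduces to an inequality for a single binomial
  coefficient.
\<close>

text \<open>\<open>(-1) ^ m * D m\<close> is the coefficient of \<open>t ^ m\<close> in
  \<open>(2 * sqrt (1 + t) - 1) / (1 + 4/3 * t)\<close>: the Cauchy product of binomial and
  geometric series, with \<open>(4/3) ^ m\<close> pulled out.\<close>

definition D :: "nat \<Rightarrow> real" where
  "D m = (4/3) ^ m * (2 * (\<Sum>i\<le>m. ((1/2) gchoose i) * (-3/4) ^ i) - 1)"

lemma gbinomial_half_rec:
  "((1/2::real) gchoose Suc (Suc j)) =
     - ((2 * real j + 1) / (2 * real j + 4) * ((1/2) gchoose Suc j))"
  using gbinomial_mult_1[of "1/2::real" "Suc j"] by (simp add: field_simps)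

lemma gbinomial_half_Suc:
  "((1/2::real) gchoose Suc j) =
     (-1) ^ j * fact (2 * j) / (fact j * fact (Suc j) * 2 ^ (2 * j + 1))"
proof (induction j)
  case 0
  then show ?case by simp
next
  case (Suc j)
  have "((1/2::real) gchoose Suc (Suc j)) =
      - (2 * real j + 1) / (2 * (real j + 2)) * ((1/2) gchoose Suc j)"
    by (simp add: gbinomial_half_rec diff_divide_distrib add_divide_distrib left_diff_distrib
      distrib_right)
  \<comment> \<open>The inserted fraction supplies the factors that complete
    \<open>fact (2 * Suc j)\<close> and \<open>fact (Suc j)\<close>.\<close>
  also have "\<dots> = - (2 * real j + 1) / (2 * (real j + 2)) * (4 * (real j + 1) / (4 * (real j + 1)))
      * ((-1) ^ j * fact (2 * j) / (fact j * fact (Suc j) * 2 ^ (2 * j + 1)))"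
    unfolding Suc by simp
  also have "\<dots> = (-1) ^ Suc j * ((2 * real j + 2) * (2 * real j + 1) * fact (2 * j))
      / (((real j + 1) * fact j) * ((real j + 2) * fact (Suc j)) * (4 * 2 ^ (2 * j + 1)))"
    by (simp add: divide_simps del: fact_Suc) (simp add: algebra_simps del: fact_Suc)
  also have "(2 * real j + 2) * (2 * real j + 1) * fact (2 * j) = fact (2 * Suc j)"
    by (simp add: algebra_simps)
  also have "(real j + 1) * fact j = fact (Suc j)"
    by (simp add: algebra_simps)
  also have "(real j + 2) * fact (Suc j) = fact (Suc (Suc j))"
    by (simp add: algebra_simps)
  also have "4 * 2 ^ (2 * j + 1) = (2::real) ^ (2 * Suc j + 1)"
    by simp
  finally show ?case .
qed

lemma sqrt_sums:
  assumes "\<bar>t\<bar> < 1"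
  shows "(\<lambda>i. ((1/2) gchoose i) * t ^ i) sums sqrt (1 + t)"
  using gen_binomial_real[OF assms, of "1/2"] assms by (simp add: powr_half_sqrt)

lemma D_Suc: "D (Suc m) = 4/3 * D m + 2 * (-1) ^ Suc m * ((1/2) gchoose Suc m)"
proof -
  have "(4/3) ^ Suc m * (-3/4) ^ Suc m = ((-1) ^ Suc m :: real)"
    by (simp flip: power_mult_distrib)
  moreover have "D (Suc m) = 4/3 * D m
      + 2 * ((4/3) ^ Suc m * (-3/4) ^ Suc m) * ((1/2) gchoose Suc m)"
    unfolding D_def sum.atMost_Suc power_Suc by (simp add: algebra_simps)
  ultimately show ?thesis by simp
qed

text \<open>The zero values of \<open>C\<close> at 0 and 1 fit the formula, since
  \<open>D 0 = 1\<close> and \<open>D 1 = 1/3\<close> are the arctangent coefficients up to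
  sign.\<close>

lemma C_eq: "C m = 1 / (2 * real m + 1) - D m"
proof (cases "m < 2")
  case True
  then have "m = 0 \<or> m = 1" by auto
  then show ?thesis by (auto simp: C_def D_def)
next
  case False
  have pow: "(4/3) ^ m = 4 * (4 ^ (m - 1) / 3 ^ m :: real)"
    using False by (cases m) (auto simp: power_divide)
  have "((1/2) gchoose i) * (-3/4) ^ i =
      - (fact (2 * i - 2) / (fact (i - 1) * fact i * 2 ^ (2 * i - 1)) * (3/4 :: real) ^ i)"
    if "i \<in> {2..m}" for i
  proof -
    from that obtain j where j: "i = Suc j" by (cases i) auto
    have "(-3/4 :: real) ^ i = (-1) ^ i * (3/4) ^ i"
      by (simp flip: power_mult_distrib)
    moreover have "(-1) ^ j * ((-1) ^ i :: real) = -1"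
      by (simp add: j flip: power_mult_distrib)
    ultimately show ?thesis
      unfolding j gbinomial_half_Suc by (auto simp: algebra_simps)
  qed
  then have tail: "(\<Sum>i=2..m. ((1/2) gchoose i) * (-3/4) ^ i) = - (\<Sum>i=2..m.
      fact (2 * i - 2) / (fact (i - 1) * fact i * 2 ^ (2 * i - 1)) * (3/4 :: real) ^ i)"
    by (simp add: sum_negf)
  \<comment> \<open>The first two terms give 1 - 3/8 = 5/8, and 2 * 5/8 - 1 = 1/4 turns
    \<open>4 ^ m\<close> into \<open>4 ^ (m - 1)\<close>.\<close>
  have total: "(\<Sum>i\<le>m. ((1/2) gchoose i) * (-3/4 :: real) ^ i)
      = 5/8 + (\<Sum>i=2..m. ((1/2) gchoose i) * (-3/4) ^ i)"
  proof -
    have "{..m} = insert 0 (insert 1 {2..m})"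
      using False by auto
    then show ?thesis by simp
  qed
  show ?thesis
    using False unfolding C_def D_def pow total tail by (simp add: algebra_simps)
qed

text \<open>Multiplying by \<open>1 + 4/3 * t\<close> telescopes by \<open>D_Suc\<close>. The exact
  remainder allows the endpoint t = 3/4, where the geometric series diverges.\<close>

lemma D_partial_sum:
  "(1 + 4/3 * t) * (\<Sum>m\<le>n. (-1) ^ m * D m * t ^ m) =
     2 * (\<Sum>m\<le>n. ((1/2) gchoose m) * t ^ m) - 1 + 4/3 * t * ((-1) ^ n * D n * t ^ n)"
proof (induction n)
  case 0
  then show ?case by (simp add: D_def)
next
  case (Suc n)
  have sq: "(-1) ^ n * ((-1) ^ n * z) = (z::real)" for z
    by (simp flip: power_mult_distrib mult.assoc)
  show ?case
    unfolding sum.atMost_Suc distrib_left Suc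
    by (simp add: D_Suc algebra_simps sq)
qed

text \<open>The bracket in \<open>D n\<close> tends to 0 because the binomial series at -3/4 sums to
  1/2; the remaining factor \<open>(4/3 * t) ^ n\<close> is at most 1.\<close>

lemma D_tendsto:
  assumes "0 \<le> t" "t \<le> 3/4"
  shows "(\<lambda>n. (-1) ^ n * D n * t ^ n) \<longlonglongrightarrow> 0"
proof -
  have "(\<lambda>n. \<Sum>i\<le>n. ((1/2) gchoose i) * (-3/4) ^ i) \<longlonglongrightarrow> sqrt (1/4)"
    using sqrt_sums[of "-3/4"] by (simp add: sums_def_le)
  then have "(\<lambda>n. 2 * (\<Sum>i\<le>n. ((1/2) gchoose i) * (-3/4) ^ i) - 1) \<longlonglongrightarrow> 2 * sqrt (1/4) - 1"
    by (intro tendsto_intros)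
  then have "(\<lambda>n. \<bar>2 * (\<Sum>i\<le>n. ((1/2) gchoose i) * (-3/4) ^ i) - 1 :: real\<bar>) \<longlonglongrightarrow> 0"
    by (intro tendsto_rabs_zero) (simp add: real_sqrt_divide)
  then show ?thesis
  proof (rule Lim_null_comparison[rotated], intro always_eventually allI)
    fix n
    have "(4/3 * t) ^ n \<le> 1"
      using assms by (intro power_le_one) auto
    then have "\<bar>r\<bar> * (4/3 * t) ^ n \<le> \<bar>r\<bar>" for r :: real
      by (simp add: mult_left_le)
    moreover have "norm ((-1) ^ n * D n * t ^ n)
        = \<bar>2 * (\<Sum>i\<le>n. ((1/2) gchoose i) * (-3/4) ^ i) - 1\<bar> * (4/3 * t) ^ n"
      unfolding power_mult_distrib using assms by (simp add: D_def abs_mult)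
    ultimately show "norm ((-1) ^ n * D n * t ^ n)
        \<le> \<bar>2 * (\<Sum>i\<le>n. ((1/2) gchoose i) * (-3/4) ^ i) - 1\<bar>"
      by metis
  qed
qed

lemma D_sums:
  assumes "0 \<le> t" "t \<le> 3/4"
  shows "(\<lambda>m. (-1) ^ m * D m * t ^ m) sums (3 / (1 + 2 * sqrt (1 + t)))"
proof -
  have "(\<lambda>n. \<Sum>m\<le>n. ((1/2) gchoose m) * t ^ m) \<longlonglongrightarrow> sqrt (1 + t)"
    using sqrt_sums[of t] assms by (simp add: sums_def_le)
  then have "(\<lambda>n. (2 * (\<Sum>m\<le>n. ((1/2) gchoose m) * t ^ m) - 1
        + 4/3 * t * ((-1) ^ n * D n * t ^ n)) / (1 + 4/3 * t))
      \<longlonglongrightarrow> (2 * sqrt (1 + t) - 1 + 4/3 * t * 0) / (1 + 4/3 * t)"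
    using assms by (intro tendsto_intros D_tendsto) auto
  moreover have "(2 * sqrt (1 + t) - 1 + 4/3 * t * 0) / (1 + 4/3 * t) = 3 / (1 + 2 * sqrt (1 + t))"
  proof -
    \<comment> \<open>With s the root, (2s - 1)(2s + 1) = 3 + 4t.\<close>
    have "sqrt (1 + t) * sqrt (1 + t) = 1 + t" "sqrt (1 + t) \<ge> 0"
      using assms by auto
    moreover from this have "1 + 2 * sqrt (1 + t) \<noteq> 0" "1 + 4/3 * t \<noteq> 0"
      using assms by linarith+
    ultimately show ?thesis
      by (simp add: frac_eq_eq) (simp add: algebra_simps)
  qed
  moreover have "(2 * (\<Sum>m\<le>n. ((1/2) gchoose m) * t ^ m) - 1
        + 4/3 * t * ((-1) ^ n * D n * t ^ n)) / (1 + 4/3 * t)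
      = (\<Sum>m\<le>n. (-1) ^ m * D m * t ^ m)" for n
    unfolding D_partial_sum[symmetric] using assms by simp
  ultimately show ?thesis
    by (simp add: sums_def_le)
qed

lemma f_sums:
  assumes "0 \<le> x" "x\<^sup>2 \<le> 3/4"
  shows "(\<lambda>m. (-1) ^ m * C m * x ^ (2 * m + 1)) sums f x"
proof -
  have "\<bar>x\<bar> \<le> 1"
    using assms abs_le_square_iff[of x 1] by simp
  then have "(\<lambda>m. (-1) ^ m * (1 / real (m * 2 + 1) * x ^ (m * 2 + 1))) sums arctan x"
    using summable_arctan_series arctan_series by (simp add: sums_iff)
  moreover have "(\<lambda>m. x * ((-1) ^ m * D m * (x\<^sup>2) ^ m)) sums (x * (3 / (1 + 2 * sqrt (1 + x\<^sup>2))))"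
    using assms by (intro sums_mult D_sums) auto
  ultimately have "(\<lambda>m. (-1) ^ m * (1 / real (m * 2 + 1) * x ^ (m * 2 + 1))
      - x * ((-1) ^ m * D m * (x\<^sup>2) ^ m)) sums f x"
    unfolding f_def by (auto dest: sums_diff simp: mult.commute)
  then show ?thesis
    by (rule sums_cong[THEN iffD1, rotated])
       (simp add: C_eq algebra_simps power_mult flip: power_mult)
qed

text \<open>The right side is 1/(2m + 1) - (3/4)/(2m + 3). In the induction the left side shrinks by
  the factor (2m + 1)/(2m + 4), the right side by less.\<close>

lemma gbinomial_half_bound:
  assumes "m \<ge> 3"
  shows "3/2 * ((-1) ^ m * ((1/2) gchoose Suc m))
    < (2 * real m + 9) / (4 * (2 * real m + 1) * (2 * real m + 3))"
  using assms
proof (induction m rule: dec_induct)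
  \<comment> \<open>Here 15/256 < 15/252; at m = 2 the bound fails, as 3/32 > 13/140.\<close>
  case base
  show ?case
    unfolding gbinomial_half_Suc by (simp add: fact_numeral)
next
  case (step n)
  let ?g = "\<lambda>m. (-1) ^ m * ((1/2::real) gchoose Suc m)"
  have "3/2 * ?g (Suc n) = (2 * real n + 1) / (2 * real n + 4) * (3/2 * ?g n)"
    by (simp add: gbinomial_half_rec)
  also have "\<dots> < (2 * real n + 1) / (2 * real n + 4) *
      ((2 * real n + 9) / (4 * (2 * real n + 1) * (2 * real n + 3)))"
    using step.IH by (intro mult_strict_left_mono) auto
  also have "\<dots> = (2 * real n + 9) / ((2 * real n + 4) * (4 * (2 * real n + 3)))"
    by (simp add: divide_simps) (simp add: algebra_simps)
  also have "\<dots> \<le> (2 * real n + 11) / ((2 * real n + 5) * (4 * (2 * real n + 3)))"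
  proof -
    have "(2 * real n + 9) * (2 * real n + 5) \<le> (2 * real n + 11) * (2 * real n + 4)"
      using step.hyps by (simp add: algebra_simps)
    then have "(2 * real n + 9) / (2 * real n + 4) \<le> (2 * real n + 11) / (2 * real n + 5)"
      by (simp add: divide_simps)
    then show ?thesis
      unfolding divide_divide_eq_left[symmetric] by (intro divide_right_mono) auto
  qed
  finally show ?case
    by (simp add: algebra_simps)
qed

text \<open>The factor 3/4, the largest value of \<open>x\<^sup>2\<close>, cancels the 4/3 in
  \<open>D_Suc\<close>, so \<open>D m\<close> drops out and a single binomial coefficient
  remains.\<close>

lemma C_Suc_less:
  assumes "m \<ge> 3"
  shows "3/4 * C (Suc m) < C m"
proof -
  have "1 / (2 * real m + 1) - 3/4 * (1 / (2 * real m + 3))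
      = (2 * real m + 9) / (4 * (2 * real m + 1) * (2 * real m + 3))"
    by (simp add: divide_simps) (simp add: algebra_simps)
  moreover have "C m - 3/4 * C (Suc m) = 1 / (2 * real m + 1) - 3/4 * (1 / (2 * real m + 3))
      - 3/2 * ((-1) ^ m * ((1/2) gchoose Suc m))"
    unfolding C_eq D_Suc by (simp add: algebra_simps)
  ultimately show ?thesis
    using gbinomial_half_bound[OF assms] by linarith
qed

lemma strict_antimono_limit_less:
  fixes X :: "nat \<Rightarrow> real"
  assumes "\<And>n. X (Suc n) < X n" and "X \<longlonglongrightarrow> L"
  shows "L < X n"
proof -
  have "decseq X"
    using assms(1) by (intro decseq_SucI less_imp_le)
  \<comment> \<open>Going one index further recovers the strictness lost in the limit.\<close>
  then have "L \<le> X (Suc n)"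
    using assms(2) by (rule decseq_ge)
  then show ?thesis
    using assms(1)[of n] by linarith
qed

text \<open>At x = sqrt 3 / 2 the unsigned terms of the convergent series strictly decrease from
  index 3 on and tend to 0, so they are positive.\<close>

lemma C_pos:
  assumes "m \<ge> 3"
  shows "C m > 0"
proof -
  define x where "x = sqrt 3 / 2"
  have x: "x > 0" "x\<^sup>2 = 3/4"
    by (simp_all add: x_def power_divide)
  have "(\<lambda>m. (-1) ^ m * C m * x ^ (2 * m + 1)) \<longlonglongrightarrow> 0"
    using f_sums[of x] x by (intro summable_LIMSEQ_zero) (auto simp: sums_iff)
  then have "(\<lambda>m. C m * x ^ (2 * m + 1)) \<longlonglongrightarrow> 0"
    by (subst tendsto_rabs_zero_iff[symmetric], subst (asm) tendsto_rabs_zero_iff[symmetric])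
       (simp add: abs_mult)
  then have "(\<lambda>n. C (n + 3) * x ^ (2 * (n + 3) + 1)) \<longlonglongrightarrow> 0"
    by (rule LIMSEQ_ignore_initial_segment)
  moreover have "C (Suc n + 3) * x ^ (2 * (Suc n + 3) + 1) < C (n + 3) * x ^ (2 * (n + 3) + 1)" for n
  proof -
    have "x ^ (2 * (Suc n + 3) + 1) = x\<^sup>2 * x ^ (2 * (n + 3) + 1)"
      by (simp flip: power_add)
    then have "C (Suc n + 3) * x ^ (2 * (Suc n + 3) + 1)
        = 3/4 * C (Suc (n + 3)) * x ^ (2 * (n + 3) + 1)"
      using x by simp
    also have "\<dots> < C (n + 3) * x ^ (2 * (n + 3) + 1)"
      using x by (intro mult_strict_right_mono C_Suc_less) auto
    finally show ?thesis .
  qed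
  ultimately have "0 < C (m - 3 + 3) * x ^ (2 * (m - 3 + 3) + 1)"
    by (rule strict_antimono_limit_less[rotated])
  then show ?thesis
    using assms x zero_less_mult_pos2[of "C m" "x ^ (2 * m + 1)"] by simp
qed

theorem theorem1:
  fixes k :: nat and x :: real
  assumes "k \<ge> 1" and "x \<in> {0<..sqrt 3 / 2}"
  shows "(\<Sum>m = 0..2 * k + 1. (- 1) ^ m * C m * x ^ (2 * m + 1)) < f x
    \<and> f x < (\<Sum>m = 0..2 * k. (- 1) ^ m * C m * x ^ (2 * m + 1))"
proof -
  have x: "0 < x" "x\<^sup>2 \<le> 3/4"
    using assms(2) power_mono[of x "sqrt 3 / 2" 2] by (auto simp: power_divide)
  have less: "C (Suc m) * x ^ (2 * Suc m + 1) < C m * x ^ (2 * m + 1)" if "m \<ge> 3" for m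
  proof -
    \<comment> \<open>Positivity of \<open>C (Suc m)\<close> lets the extreme point control every
      smaller x.\<close>
    have "x\<^sup>2 * C (Suc m) \<le> 3/4 * C (Suc m)"
      using C_pos[of "Suc m"] that x by (intro mult_right_mono) auto
    also have "\<dots> < C m"
      using that by (rule C_Suc_less)
    finally have "x\<^sup>2 * C (Suc m) * x ^ (2 * m + 1) < C m * x ^ (2 * m + 1)"
      using x by (intro mult_strict_right_mono) auto
    then show ?thesis
      by (simp add: power2_eq_square mult_ac)
  qed
  define S where "S n = (\<Sum>m = 0..n. (- 1) ^ m * C m * x ^ (2 * m + 1))" for n
  have lim: "S \<longlonglongrightarrow> f x"
    using f_sums[of x] x by (simp add: sums_def_le S_def[abs_def] atLeast0AtMost)
  \<comment> \<open>\<open>c\<close> selects the parity. Since k is at least 1, the increments of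
    both subsequences involve only terms of index 3 or more.\<close>
  have sub: "(\<lambda>n. S (2 * (n + k) + c)) \<longlonglongrightarrow> f x" for c
    using LIMSEQ_subseq_LIMSEQ[OF lim, of "\<lambda>n. 2 * (n + k) + c"]
    by (simp add: strict_mono_def o_def)
  have "S (2 * (Suc n + k) + 0) < S (2 * (n + k) + 0)" for n
    using less[of "2 * (n + k) + 1"] assms(1) by (simp add: S_def)
  then have "f x < S (2 * (0 + k) + 0)"
    using sub by (rule strict_antimono_limit_less)
  \<comment> \<open>The odd partial sums increase, so they are negated to fit
    \<open>strict_antimono_limit_less\<close>.\<close>
  moreover have "- S (2 * (Suc n + k) + 1) < - S (2 * (n + k) + 1)" for n
    using less[of "2 * (n + k) + 2"] assms(1) by (simp add: S_def)
  then have "- f x < - S (2 * (0 + k) + 1)"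
    using tendsto_minus[OF sub] by (rule strict_antimono_limit_less)
  ultimately show ?thesis
    by (simp add: S_def)
qed

end
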